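(* There is no Baire realiser that is Kleene-computable (S1–S9) in a functional of type 2; that is, for every type-3 functional $\xi$ such that $\xi(\lambda n.Y_n)\in\bigcap_{n\in\mathbb{N}}Y_n$ for every sequence $(Y_n)_{n\in\mathbb{N}}$ of dense open sets of reals, and every type-2 functional $F$, $\xi$ is not computable in $F$.
   Context: Computability is Kleene's higher-order computability S1–S9; metatheory ZFC. Reals are coded by fast-converging Cauchy sequences of rationals (elements of $\mathbb{N}^{\mathbb{N}}$). A set of reals is given by its characteristic function $Y:\mathbb{R}\to\mathbb{R}$, $x\in Y$ meaning $Y(x)>0$; $Y$ is open if for every $x\in Y$ there is a rational $r>0$ with $B(x,r)\subseteq Y$; dense means it meets every non-empty open interval. *)

theory Defs
  imports "HOL-Analysis.Analysis" "HOL-Library.Nat_Bijection" "HOL-Library.Countable"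
begin

section \<open>Kleene's schemes S1--S9\<close>

text \<open>
  Arguments are total objects of pure type 0, 1 or 2. This is all that is needed to compute
  relative to type-2 functionals: application of an argument of type \<open>j + 2\<close> (scheme S8) only
  introduces new arguments of type \<open>j\<close>, so no argument of higher type ever arises from arguments
  of type at most 2.
\<close>

datatype arg =
    T0 nat
  | T1 "nat \<Rightarrow> nat"
  | T2 "(nat \<Rightarrow> nat) \<Rightarrow> nat"

text \<open>
  \<open>kleene e as z\<close> means that \<open>{e}(as)\<close> converges with value \<open>z\<close>. An index is the code of a finite
  sequence headed by the number of its scheme; schemes are uniform in the argument list, so an
  index carries no arity. In S6 the list \<open>p\<close> is a permutation of the argument positions. In S8 the
  premises say that \<open>h\<close> is the total function \<open>\<lambda>x. {d}(x, \<phi>, as)\<close>, that is, every one of these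
  computations converges.
\<close>

inductive kleene :: "nat \<Rightarrow> arg list \<Rightarrow> nat \<Rightarrow> bool" where
  S1: "kleene (list_encode [1]) (T0 x # as) (Suc x)"
| S2: "kleene (list_encode [2, q]) as q"
| S3: "kleene (list_encode [3]) (T0 x # as) x"
| S4: "kleene d as y \<Longrightarrow> kleene c (T0 y # as) z \<Longrightarrow> kleene (list_encode [4, c, d]) as z"
| S5_zero: "kleene c as z \<Longrightarrow> kleene (list_encode [5, c, d]) (T0 0 # as) z"
| S5_Suc: "kleene (list_encode [5, c, d]) (T0 x # as) y \<Longrightarrow> kleene d (T0 x # T0 y # as) z \<Longrightarrow>
    kleene (list_encode [5, c, d]) (T0 (Suc x) # as) z"
| S6: "distinct p \<Longrightarrow> set p = {..<length as} \<Longrightarrow> kleene d (map (\<lambda>i. as ! i) p) z \<Longrightarrow>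
    kleene (list_encode [6, d, list_encode p]) as z"
| S7: "kleene (list_encode [7]) (T1 f # T0 x # as) (f x)"
| S8: "(\<And>x. kleene d (T0 x # T2 \<phi> # as) (h x)) \<Longrightarrow>
    kleene (list_encode [8, d]) (T2 \<phi> # as) (\<phi> h)"
| S9: "m \<le> length as \<Longrightarrow> kleene d (take m as) z \<Longrightarrow>
    kleene (list_encode [9, m]) (T0 d # as) z"


section \<open>Coded reals and real functions\<close>

definition rat_seq :: "(nat \<Rightarrow> nat) \<Rightarrow> nat \<Rightarrow> real" where
  "rat_seq x n = of_rat (nat_to_rat_surj (x n))"

definition real_code :: "(nat \<Rightarrow> nat) \<Rightarrow> bool" where
  "real_code x \<longleftrightarrow> (\<forall>n i. \<bar>rat_seq x n - rat_seq x (n + i)\<bar> < 1 / 2 ^ n)"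

definition real_val :: "(nat \<Rightarrow> nat) \<Rightarrow> real" where
  "real_val x = lim (rat_seq x)"

text \<open>
  \<open>Y\<close> represents \<open>y : \<real> \<rightarrow> \<real>\<close>; its values on sequences that do not code a real are arbitrary.
\<close>

definition represents :: "((nat \<Rightarrow> nat) \<Rightarrow> nat \<Rightarrow> nat) \<Rightarrow> (real \<Rightarrow> real) \<Rightarrow> bool" where
  "represents Y y \<longleftrightarrow>
    (\<forall>x. real_code x \<longrightarrow> real_code (Y x) \<and> real_val (Y x) = y (real_val x))"

definition represents_seq ::
    "(nat \<Rightarrow> (nat \<Rightarrow> nat) \<Rightarrow> nat \<Rightarrow> nat) \<Rightarrow> (nat \<Rightarrow> real \<Rightarrow> real) \<Rightarrow> bool" where
  "represents_seq Y y \<longleftrightarrow> (\<forall>n. represents (Y n) (y n))"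

definition set_of :: "(real \<Rightarrow> real) \<Rightarrow> real set" where
  "set_of y = {x. y x > 0}"

definition dense_set :: "real set \<Rightarrow> bool" where
  "dense_set U \<longleftrightarrow> (\<forall>a b. a < b \<longrightarrow> U \<inter> {a<..<b} \<noteq> {})"


section \<open>Baire realisers\<close>

text \<open>
  The type of functionals \<open>(\<nat> \<rightarrow> (\<real> \<rightarrow> \<real>)) \<rightarrow> \<real>\<close> acting on codes. No extensionality is imposed:
  different codes of the same sequence may be sent to codes of different reals.
\<close>

type_synonym real_functional = "(nat \<Rightarrow> (nat \<Rightarrow> nat) \<Rightarrow> nat \<Rightarrow> nat) \<Rightarrow> nat \<Rightarrow> nat"

definition baire_realiser :: "real_functional \<Rightarrow> bool" where
  "baire_realiser \<xi> \<longleftrightarrow>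
    (\<forall>Y y. represents_seq Y y \<and> (\<forall>n. open (set_of (y n)) \<and> dense_set (set_of (y n))) \<longrightarrow>
      real_code (\<xi> Y) \<and> real_val (\<xi> Y) \<in> (\<Inter>n. set_of (y n)))"

text \<open>
  The standard identification of the type \<open>\<nat> \<rightarrow> (\<nat>\<^sup>\<nat> \<rightarrow> \<nat>\<^sup>\<nat>)\<close> with the pure type 2: the value
  \<open>Y n x k\<close> is the value of \<open>pure2 Y\<close> at the sequence whose first entry codes the pair \<open>(n, k)\<close> and
  whose tail is \<open>x\<close>.
\<close>

definition pure2 :: "(nat \<Rightarrow> (nat \<Rightarrow> nat) \<Rightarrow> nat \<Rightarrow> nat) \<Rightarrow> (nat \<Rightarrow> nat) \<Rightarrow> nat" where
  "pure2 Y f = (case prod_decode (f 0) of (n, k) \<Rightarrow> Y n (\<lambda>i. f (Suc i)) k)"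

text \<open>
  A single index has to compute \<open>\<xi>(Y)(k)\<close> from \<open>F\<close>, \<open>Y\<close> and \<open>k\<close>, for all \<open>Y\<close> in the domain of
  \<open>\<xi>\<close>, i.e. for all codes of sequences of functions \<open>\<real> \<rightarrow> \<real>\<close>.
\<close>

definition kleene_computable_in :: "real_functional \<Rightarrow> ((nat \<Rightarrow> nat) \<Rightarrow> nat) \<Rightarrow> bool" where
  "kleene_computable_in \<xi> F \<longleftrightarrow>
    (\<exists>e. \<forall>Y. (\<exists>y. represents_seq Y y) \<longrightarrow>
      (\<forall>k. kleene e [T2 F, T2 (pure2 Y), T0 k] (\<xi> Y k)))"

end

theory Submission
  imports Defs
begin

text \<open>
  Suppose \<open>\<xi>\<close> is computable in \<open>F\<close>. Let \<open>Y\<^sub>n\<close> be the reals without the point that a partial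
  injection \<open>i : \<real> \<rightharpoonup> \<nat>\<close> maps to \<open>n\<close>. It suffices to find \<open>i\<close> such that every real computable in
  \<open>F\<close> and \<open>Y\<close> lies in its domain, since then \<open>\<xi>(Y)\<close> is a computable real omitted by some \<open>Y\<^sub>n\<close>.
  The circularity is resolved by Zorn's lemma in place of Gandy selection: relative to a partial
  \<open>i\<close>, a computation that applies \<open>Y\<close> at a real outside the domain of \<open>i\<close> diverges. Order by
  inclusion the partial functions \<open>i\<close> such that \<open>i(x)\<close> is always an index of \<open>x\<close> relative to
  \<open>i\<close> itself. Computations persist under extension, so chains have upper bounds; and a maximal
  \<open>i\<close> contains every real computable relative to it, so that making \<open>Y\<close> total adds no new
  computations.
\<close>

section \<open>Computations relative to a partial functional\<close>

datatype sarg = SN nat | SF | SY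

instance sarg :: countable
  by countable_datatype

text \<open>
  The schemes for argument lists made of numbers, \<open>F\<close> and a symbol for a partial functional with
  graph \<open>P\<close>. Such lists contain no functions, so they can be coded by natural numbers.
\<close>

inductive pkleene ::
    "((nat \<Rightarrow> nat) \<Rightarrow> nat) \<Rightarrow> ((nat \<Rightarrow> nat) \<Rightarrow> nat \<Rightarrow> bool) \<Rightarrow> nat \<Rightarrow> sarg list \<Rightarrow> nat \<Rightarrow> bool"
  for F P where
  S1: "pkleene F P (list_encode [1]) (SN x # as) (Suc x)"
| S2: "pkleene F P (list_encode [2, q]) as q"
| S3: "pkleene F P (list_encode [3]) (SN x # as) x"
| S4: "pkleene F P d as y \<Longrightarrow> pkleene F P c (SN y # as) z \<Longrightarrow>
    pkleene F P (list_encode [4, c, d]) as z"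
| S5_zero: "pkleene F P c as z \<Longrightarrow> pkleene F P (list_encode [5, c, d]) (SN 0 # as) z"
| S5_Suc: "pkleene F P (list_encode [5, c, d]) (SN x # as) y \<Longrightarrow>
    pkleene F P d (SN x # SN y # as) z \<Longrightarrow> pkleene F P (list_encode [5, c, d]) (SN (Suc x) # as) z"
| S6: "distinct p \<Longrightarrow> set p = {..<length as} \<Longrightarrow> pkleene F P d (map (\<lambda>i. as ! i) p) z \<Longrightarrow>
    pkleene F P (list_encode [6, d, list_encode p]) as z"
| S8_F: "(\<And>x. pkleene F P d (SN x # SF # as) (h x)) \<Longrightarrow>
    pkleene F P (list_encode [8, d]) (SF # as) (F h)"
| S8_Y: "(\<And>x. pkleene F P d (SN x # SY # as) (h x)) \<Longrightarrow> P h v \<Longrightarrow>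
    pkleene F P (list_encode [8, d]) (SY # as) v"
| S9: "m \<le> length as \<Longrightarrow> pkleene F P d (take m as) z \<Longrightarrow>
    pkleene F P (list_encode [9, m]) (SN d # as) z"

lemma list_encode_inject: "list_encode xs = list_encode ys \<longleftrightarrow> xs = ys"
  by (metis list_encode_inverse)

lemma pkleene_mono:
  assumes "pkleene F P e as z" and "\<And>h v. P h v \<Longrightarrow> Q h v"
  shows "pkleene F Q e as z"
  using assms(1)
proof induction
  case (S8_Y d as h v)
  show ?case
    by (rule pkleene.S8_Y[where h = h]) (fact S8_Y.IH, rule assms(2), fact S8_Y.hyps)
qed (rule pkleene.intros; assumption)+

text \<open>Index and arguments fix the scheme; in S8 the induction hypothesis at every
  \<open>x\<close> fixes the function \<open>h\<close> handed to \<open>F\<close> or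
  \<open>P\<close>.\<close>

lemma pkleene_deterministic:
  assumes "pkleene F P e as z" and "pkleene F P e as z'"
    and P: "\<And>h v v'. P h v \<Longrightarrow> P h v' \<Longrightarrow> v = v'"
  shows "z = z'"
  using assms(1,2)
proof (induction arbitrary: z')
  case (S4 d as y c z)
  from S4.prems show ?case
    by (cases rule: pkleene.cases) (auto simp del: list_encode.simps simp: list_encode_inject dest: S4.IH)
next
  case (S5_zero c as z d)
  from S5_zero.prems show ?case
    by (cases rule: pkleene.cases) (auto simp del: list_encode.simps simp: list_encode_inject dest: S5_zero.IH)
next
  case (S5_Suc c d x as y z)
  from S5_Suc.prems show ?case
    by (cases rule: pkleene.cases) (auto simp del: list_encode.simps simp: list_encode_inject dest: S5_Suc.IH)
next
  case (S6 p as d z)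
  from S6.prems show ?case
    by (cases rule: pkleene.cases) (auto simp del: list_encode.simps simp: list_encode_inject dest: S6.IH)
next
  case (S8_F d as h)
  from S8_F.prems obtain h' where h': "\<And>x. pkleene F P d (SN x # SF # as) (h' x)" "z' = F h'"
    by (cases rule: pkleene.cases) (auto simp del: list_encode.simps simp: list_encode_inject)
  then have "h = h'"
    using S8_F.IH by blast
  then show ?case
    using h' by simp
next
  case (S8_Y d as h v)
  from S8_Y.prems obtain h' where h': "\<And>x. pkleene F P d (SN x # SY # as) (h' x)" "P h' z'"
    by (cases rule: pkleene.cases) (auto simp del: list_encode.simps simp: list_encode_inject)
  then have "h = h'"
    using S8_Y.IH by blast
  then show ?case
    using h' S8_Y.hyps P by blast
next
  case (S9 m as d z)
  from S9.prems show ?case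
    by (cases rule: pkleene.cases) (auto simp del: list_encode.simps simp: list_encode_inject dest: S9.IH)
qed (erule pkleene.cases; auto simp del: list_encode.simps simp: list_encode_inject)+

fun interp :: "((nat \<Rightarrow> nat) \<Rightarrow> nat) \<Rightarrow> ((nat \<Rightarrow> nat) \<Rightarrow> nat) \<Rightarrow> sarg \<Rightarrow> arg" where
  "interp F G (SN n) = T0 n"
| "interp F G SF = T2 F"
| "interp F G SY = T2 G"

lemma interp_eq_T0 [simp]: "T0 n = interp F G s \<longleftrightarrow> s = SN n"
  by (cases s) auto

lemma interp_neq_T1 [simp]: "T1 f \<noteq> interp F G s"
  by (cases s) auto

lemma interp_eq_T2:
  "T2 \<phi> = interp F G s \<longleftrightarrow> s = SF \<and> \<phi> = F \<or> s = SY \<and> \<phi> = G"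
  by (cases s) auto

text \<open>\<open>total\<close> asks \<open>P\<close> to agree with \<open>G\<close> only at
  functions computed relative to \<open>P\<close> itself; by induction, S8 hands no others to
  \<open>G\<close>.\<close>

lemma kleene_imp_pkleene:
  assumes "kleene e (map (interp F G) ss) z"
    and total: "\<And>d ss h. (\<And>x. pkleene F P d (SN x # ss) (h x)) \<Longrightarrow> P h (G h)"
  shows "pkleene F P e ss z"
  using assms(1)
proof (induction e "map (interp F G) ss" z arbitrary: ss)
  case (S4 d y c z)
  then show ?case
    by (intro pkleene.S4[of F P d ss y]) auto
next
  case (S5_Suc c d x as y z)
  then obtain ss' where ss: "ss = SN (Suc x) # ss'" "as = map (interp F G) ss'"
    by (auto simp: Cons_eq_map_conv)
  show ?case
    unfolding ss by (rule pkleene.S5_Suc[where y = y]) (use ss S5_Suc.hyps in auto)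
next
  case (S6 p d z)
  have "map (\<lambda>i. map (interp F G) ss ! i) p = map (interp F G) (map (\<lambda>i. ss ! i) p)"
    using S6.hyps(2) by auto
  then show ?case
    using S6.hyps by (intro pkleene.S6) auto
next
  case (S8 d \<phi> as h)
  from S8.hyps(3) obtain s ss' where ss: "ss = s # ss'" "as = map (interp F G) ss'"
      "T2 \<phi> = interp F G s"
    by (auto simp: Cons_eq_map_conv)
  have h: "pkleene F P d (SN x # ss) (h x)" for x
    by (rule S8.hyps(2)) (use ss in auto)
  from ss(3) consider "s = SF" "\<phi> = F" | "s = SY" "\<phi> = G"
    by (auto simp: interp_eq_T2)
  then show ?case
  proof cases
    case 1
    have "pkleene F P (list_encode [8, d]) (SF # ss') (F h)"
      by (rule pkleene.S8_F) (use h ss 1 in simp)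
    then show ?thesis
      using ss 1 by simp
  next
    case 2
    have "pkleene F P (list_encode [8, d]) (SY # ss') (G h)"
      by (rule pkleene.S8_Y[where h = h]) (use h ss 2 total[OF h] in simp_all)
    then show ?thesis
      using ss 2 by simp
  qed
next
  case (S9 m as d z)
  then obtain ss' where ss: "ss = SN d # ss'" "as = map (interp F G) ss'"
    by (auto simp: Cons_eq_map_conv)
  show ?case
    unfolding ss by (rule pkleene.S9) (use ss S9.hyps in \<open>auto simp: take_map\<close>)
qed (auto simp: Cons_eq_map_conv simp del: list_encode.simps One_nat_def
      intro: pkleene.S1 pkleene.S2 pkleene.S3 pkleene.S5_zero)


section \<open>Sequences of punctured lines\<close>

definition const_code :: "rat \<Rightarrow> nat" where
  "const_code q = (SOME n. nat_to_rat_surj n = q)"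

lemma rat_seq_const_code: "rat_seq (\<lambda>_. const_code q) n = of_rat q"
  unfolding rat_seq_def const_code_def
  by (metis (mono_tags, lifting) surj_nat_to_rat_surj surj_def someI_ex)

lemma real_code_const: "real_code (\<lambda>_. const_code q)"
  by (simp add: real_code_def rat_seq_const_code)

lemma real_val_const: "real_val (\<lambda>_. const_code q) = of_rat q"
  by (simp add: real_val_def rat_seq_const_code[abs_def])

text \<open>\<open>R\<close> is the graph of the partial function \<open>i\<close>.\<close>

definition punctured :: "(real \<times> nat) set \<Rightarrow> nat \<Rightarrow> real \<Rightarrow> real" where
  "punctured R n x = (if (x, n) \<in> R then 0 else 1)"

definition punctured_code :: "(real \<times> nat) set \<Rightarrow> nat \<Rightarrow> (nat \<Rightarrow> nat) \<Rightarrow> nat \<Rightarrow> nat" where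
  "punctured_code R n f k = const_code (if (real_val f, n) \<in> R then 0 else 1)"

text \<open>Values of \<open>punctured_code R\<close> outside \<open>Domain R\<close> are withheld,
  as a larger \<open>R\<close> could change them.\<close>

definition punctured_graph :: "(real \<times> nat) set \<Rightarrow> (nat \<Rightarrow> nat) \<Rightarrow> nat \<Rightarrow> bool" where
  "punctured_graph R f v \<longleftrightarrow>
    real_val (\<lambda>i. f (Suc i)) \<in> Domain R \<and> v = pure2 (punctured_code R) f"

lemma represents_seq_punctured: "represents_seq (punctured_code R) (punctured R)"
  by (simp add: represents_seq_def represents_def punctured_code_def[abs_def] punctured_def
      real_code_const real_val_const)

lemma set_of_punctured: "set_of (punctured R n) = - {x. (x, n) \<in> R}"
  by (auto simp: set_of_def punctured_def)

lemma open_dense_punctured: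
  assumes "\<And>x x'. (x, n) \<in> R \<Longrightarrow> (x', n) \<in> R \<Longrightarrow> x = x'"
  shows "open (set_of (punctured R n))" and "dense_set (set_of (punctured R n))"
proof -
  have fin: "finite {x. (x, n) \<in> R}"
  proof (cases "\<exists>a. (a, n) \<in> R")
    case True
    then obtain a where "(a, n) \<in> R" by blast
    then have "{x. (x, n) \<in> R} \<subseteq> {a}" using assms by blast
    then show ?thesis by (rule finite_subset) simp
  qed simp
  then show "open (set_of (punctured R n))"
    unfolding set_of_punctured by (simp add: finite_imp_closed open_Compl)
  have "- {x. (x, n) \<in> R} \<inter> {a<..<b} \<noteq> {}" if "a < b" for a b
  proof
    assume "- {x. (x, n) \<in> R} \<inter> {a<..<b} = {}"
    then have "{a<..<b} \<subseteq> {x. (x, n) \<in> R}" by blast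
    then show False
      using fin infinite_Ioo[OF that] finite_subset by blast
  qed
  then show "dense_set (set_of (punctured R n))"
    by (simp add: dense_set_def set_of_punctured)
qed

text \<open>A real with a number in \<open>R\<close> gets no second one in the single-valued
  \<open>S\<close>, so the answers at it stay the same.\<close>

lemma punctured_graph_mono:
  assumes "single_valued S" and "R \<subseteq> S" and "punctured_graph R f v"
  shows "punctured_graph S f v"
proof -
  from assms(3) obtain m where m: "(real_val (\<lambda>i. f (Suc i)), m) \<in> R"
    by (auto simp: punctured_graph_def)
  then have "(real_val (\<lambda>i. f (Suc i)), n) \<in> R \<longleftrightarrow> (real_val (\<lambda>i. f (Suc i)), n) \<in> S" for n
    using assms(1,2) by (auto dest: single_valuedD)
  then have "pure2 (punctured_code R) f = pure2 (punctured_code S) f"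
    by (simp add: pure2_def punctured_code_def split: prod.split)
  then show ?thesis
    using assms(2,3) by (auto simp: punctured_graph_def)
qed


section \<open>The maximal assignment of indices\<close>

text \<open>
  The shift \<open>s\<close> is needed because \<open>pure2 Y\<close> applies \<open>Y\<close> to the tail of its argument, and the hole
  between \<open>l\<close> and \<open>r\<close> because S8 abstracts the first argument whereas \<open>\<xi>(Y)\<close> is computed with
  the last one varying.
\<close>

definition index_of ::
    "((nat \<Rightarrow> nat) \<Rightarrow> nat) \<Rightarrow> (real \<times> nat) set \<Rightarrow> nat \<Rightarrow> real \<Rightarrow> bool" where
  "index_of F R n x \<longleftrightarrow>
    (\<exists>d l r s h. n = to_nat (d :: nat, l, r, s :: nat) \<and>
      (\<forall>k. pkleene F (punctured_graph R) d (l @ SN k # r) (h k)) \<and>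
      x = real_val (\<lambda>k. h (k + s)))"

definition assignment :: "((nat \<Rightarrow> nat) \<Rightarrow> nat) \<Rightarrow> (real \<times> nat) set \<Rightarrow> bool" where
  "assignment F R \<longleftrightarrow> single_valued R \<and> (\<forall>(x, n) \<in> R. index_of F R n x)"

lemma index_of_mono:
  assumes "index_of F R n x" and "single_valued S" and "R \<subseteq> S"
  shows "index_of F S n x"
proof -
  have mono: "pkleene F (punctured_graph S) d as z" if "pkleene F (punctured_graph R) d as z" for d as z
    using that punctured_graph_mono[OF assms(2,3)] by (rule pkleene_mono)
  then show ?thesis
    using assms(1) unfolding index_of_def
    by (elim ex_forward conj_forward all_forward mono)
qed

text \<open>The number codes the whole computation. Hence assignments are injective, and each line
  loses at most one point.\<close>

lemma index_of_deterministic: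
  assumes "index_of F R n x" and "index_of F R n x'"
  shows "x = x'"
proof -
  obtain d l r s h where 1: "n = to_nat (d :: nat, l :: sarg list, r :: sarg list, s :: nat)"
      "\<And>k. pkleene F (punctured_graph R) d (l @ SN k # r) (h k)" "x = real_val (\<lambda>k. h (k + s))"
    using assms(1) unfolding index_of_def by blast
  obtain d' l' r' s' h' where 2: "n = to_nat (d' :: nat, l' :: sarg list, r' :: sarg list, s' :: nat)"
      "\<And>k. pkleene F (punctured_graph R) d' (l' @ SN k # r') (h' k)"
      "x' = real_val (\<lambda>k. h' (k + s'))"
    using assms(2) unfolding index_of_def by blast
  have eq: "d = d'" "l = l'" "r = r'" "s = s'"
    using 1(1) 2(1) by auto
  have "h k = h' k" for k
    by (rule pkleene_deterministic[OF 1(2) 2(2)[folded eq]]) (simp add: punctured_graph_def)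
  then show ?thesis
    using 1(3) 2(3) eq by simp
qed

lemma assignment_Union_chain:
  assumes "subset.chain {R. assignment F R} C"
  shows "assignment F (\<Union>C)"
proof -
  have A: "assignment F R" if "R \<in> C" for R
    using assms that by (auto simp: subset_chain_def)
  have sv: "single_valued (\<Union>C)"
  proof (rule single_valuedI)
    fix x n n'
    assume "(x, n) \<in> \<Union>C" "(x, n') \<in> \<Union>C"
    then obtain R S where "R \<in> C" "S \<in> C" "(x, n) \<in> R" "(x, n') \<in> S" by blast
    moreover from this have "R \<subseteq> S \<or> S \<subseteq> R"
      using assms by (auto simp: subset_chain_def)
    ultimately show "n = n'"
      using A unfolding assignment_def by (meson single_valuedD subsetD)
  qed
  have "index_of F (\<Union>C) n x" if "(x, n) \<in> R" "R \<in> C" for x n R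
    using A[OF that(2)] that index_of_mono[OF _ sv, of F R n x]
    unfolding assignment_def by blast
  then show ?thesis
    using sv unfolding assignment_def by blast
qed

lemma ex_closed_assignment:
  obtains R where "assignment F R" and "\<And>n x. index_of F R n x \<Longrightarrow> x \<in> Domain R"
proof -
  have "\<exists>R\<in>{R. assignment F R}. \<forall>S\<in>{R. assignment F R}. R \<subseteq> S \<longrightarrow> S = R"
    by (rule subset_Zorn') (use assignment_Union_chain in blast)
  then obtain R where R: "assignment F R"
      and maximal: "\<And>S. assignment F S \<Longrightarrow> R \<subseteq> S \<Longrightarrow> S = R"
    by blast
  have "x \<in> Domain R" if n: "index_of F R n x" for n x
  proof (rule ccontr)
    assume x: "x \<notin> Domain R"
    let ?S = "insert (x, n) R"
    have sv: "single_valued ?S"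
      using R x by (auto simp: assignment_def single_valued_def)
    \<comment> \<open>\<open>x\<close> and the old points keep their indices when \<open>R\<close>
      grows to \<open>?S\<close>.\<close>
    have "assignment F ?S"
      using R n sv index_of_mono[OF _ sv] by (fastforce simp: assignment_def)
    then show False
      using maximal[of ?S] x by blast
  qed
  with R show thesis
    using that by blast
qed

theorem theorem6p6:
  fixes \<xi> :: real_functional
    and F :: "(nat \<Rightarrow> nat) \<Rightarrow> nat"
  assumes "baire_realiser \<xi>"
  shows "\<not> kleene_computable_in \<xi> F"
proof
  assume "kleene_computable_in \<xi> F"
  then obtain e where e: "\<And>Y y k. represents_seq Y y \<Longrightarrow>
      kleene e [T2 F, T2 (pure2 Y), T0 k] (\<xi> Y k)"
    unfolding kleene_computable_in_def by blast
  obtain R where R: "assignment F R" and closed: "\<And>n x. index_of F R n x \<Longrightarrow> x \<in> Domain R"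
    using ex_closed_assignment by blast
  let ?Y = "punctured_code R"
  have "x = x'" if "(x, n) \<in> R" "(x', n) \<in> R" for x x' n
    using R that index_of_deterministic unfolding assignment_def by blast
  then have "real_val (\<xi> ?Y) \<in> (\<Inter>n. set_of (punctured R n))"
    using assms represents_seq_punctured[of R] open_dense_punctured[of _ R]
    unfolding baire_realiser_def by blast
  then have notin: "real_val (\<xi> ?Y) \<notin> Domain R"
    by (auto simp: set_of_punctured)
  \<comment> \<open>The tail of a computed \<open>h\<close> has an index with shift 1, so closure
    puts its real in \<open>Domain R\<close>: no computation meets a gap of the graph.\<close>
  have "punctured_graph R h (pure2 ?Y h)"
    if "\<And>x. pkleene F (punctured_graph R) d (SN x # ss) (h x)" for d ss h
  proof -
    have "index_of F R (to_nat (d, [] :: sarg list, ss, 1 :: nat)) (real_val (\<lambda>k. h (k + 1)))"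
      unfolding index_of_def using that by (metis append_Nil)
    then show ?thesis
      using closed by (simp add: punctured_graph_def)
  qed
  then have "pkleene F (punctured_graph R) e ([SF, SY] @ SN k # []) (\<xi> ?Y k)" for k
    using e[OF represents_seq_punctured[of R], of k]
    by (intro kleene_imp_pkleene[where G = "pure2 ?Y"]) auto
  \<comment> \<open>Here the hole for \<open>k\<close> is last and nothing is shifted; closure now
    contradicts \<open>notin\<close>.\<close>
  then have "index_of F R (to_nat (e, [SF, SY], [] :: sarg list, 0 :: nat)) (real_val (\<lambda>k. \<xi> ?Y (k + 0)))"
    unfolding index_of_def by blast
  then show False
    using closed notin by simp
qed

end
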